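(* The half-generalized degree polynomial and the subtree polynomial of a tree determine each other linearly. Specifically, fix $n$ and fixed orderings of the index sets below. There exist nonsingular integer matrices $\mathsf{P}$ (of size $n\times n$) and $\mathsf{M},\mathsf{N}$ (square, of size $\binom{n-1}{2}$), depending only on $n$, such that for every tree $T$ on $n$ vertices, $\mathsf{P}\mathsf{H}_1=\mathsf{S}_1$ and $\mathsf{M}\mathsf{H}_2=\mathsf{N}\mathsf{S}_2$, where \[\mathsf{H}_1=[\eta_T(0,b)]_{b=0}^{n-1},\quad \mathsf{H}_2=[\eta_T(a,b)]_{a,b\ge1,\ a+b\le n-1},\quad \mathsf{S}_1=[s_T(k,k)]_{k=0}^{n-1},\quad \mathsf{S}_2=[s_T(i,j)]_{2\le j\le i\le n-1}.\]
   Context: Let $T=(V,E)$ be a tree with $n$ vertices. A subtree is a connected subgraph with nonempty vertex set, identified with its vertex set $A$, which must induce a connected subgraph. For a subtree $S$, let $e(S)$ be the number of edges of $T$ with both endpoints in $S$, and $d(S)$ the number of edges of $T$ with exactly one endpoint in $S$. A leaf edge of $S$ is an edge of $S$ with at least one endpoint a leaf of $S$, and $\ell(S)$ is the number of leaf edges of $S$. Set $\eta_T(a,b)$ to be the number of subtrees $S$ with $e(S)=a$ and $d(S)=b$, and $s_T(i,j)$ the number of subtrees $S$ with $e(S)=i$ and $\ell(S)=j$. The half-generalized degree polynomial is $\sum_{S}y^{d(S)}z^{e(S)}$ and the subtree polynomial is $\sum_S q^{e(S)}r^{\ell(S)}$, both summed over all subtrees $S$ of $T$.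
   Formalization: For even n no integer P exists: on a path with n even all entries of H_1 are even, but s(1,1)=n-1 is odd. So for even n the row k=1 of P may be half-integral (2 times it is integral); all other rows, and all of P for odd n, are integral. *)

theory Defs
  imports "Jordan_Normal_Form.Determinant"
begin

text \<open>A graph is a pair of a vertex set \<open>V\<close> and a set \<open>E\<close> of two-element subsets of \<open>V\<close>.\<close>

definition simple_graph :: "'a set \<Rightarrow> 'a set set \<Rightarrow> bool" where
  "simple_graph V E \<longleftrightarrow> finite V \<and> (\<forall>e\<in>E. e \<subseteq> V \<and> card e = 2)"

definition induced_adj :: "'a set set \<Rightarrow> 'a set \<Rightarrow> ('a \<times> 'a) set" where
  "induced_adj E A = {(u, v). u \<in> A \<and> v \<in> A \<and> {u, v} \<in> E}"

definition induces_connected :: "'a set set \<Rightarrow> 'a set \<Rightarrow> bool" where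
  "induces_connected E A \<longleftrightarrow> A \<noteq> {} \<and> (\<forall>u\<in>A. \<forall>v\<in>A. (u, v) \<in> (induced_adj E A)\<^sup>*)"

definition is_cycle :: "'a set set \<Rightarrow> 'a list \<Rightarrow> bool" where
  "is_cycle E xs \<longleftrightarrow> length xs \<ge> 3 \<and> distinct xs \<and>
     (\<forall>i<length xs. {xs ! i, xs ! (Suc i mod length xs)} \<in> E)"

definition is_tree :: "'a set \<Rightarrow> 'a set set \<Rightarrow> bool" where
  "is_tree V E \<longleftrightarrow> simple_graph V E \<and> induces_connected E V \<and> (\<nexists>xs. is_cycle E xs)"

definition subtree :: "'a set \<Rightarrow> 'a set set \<Rightarrow> 'a set \<Rightarrow> bool" where
  "subtree V E A \<longleftrightarrow> A \<subseteq> V \<and> induces_connected E A"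

definition inner_edges :: "'a set set \<Rightarrow> 'a set \<Rightarrow> 'a set set" where
  "inner_edges E A = {e \<in> E. e \<subseteq> A}"

definition boundary_edges :: "'a set set \<Rightarrow> 'a set \<Rightarrow> 'a set set" where
  "boundary_edges E A = {e \<in> E. card (e \<inter> A) = 1}"

definition is_leaf :: "'a set set \<Rightarrow> 'a set \<Rightarrow> 'a \<Rightarrow> bool" where
  "is_leaf E A v \<longleftrightarrow> v \<in> A \<and> card {e \<in> inner_edges E A. v \<in> e} = 1"

text \<open>A single-edge subtree has exactly one leaf edge, although it has two leaves.\<close>

definition leaf_edges :: "'a set set \<Rightarrow> 'a set \<Rightarrow> 'a set set" where
  "leaf_edges E A = {e \<in> inner_edges E A. \<exists>v\<in>e. is_leaf E A v}"

definition eta_T :: "'a set \<Rightarrow> 'a set set \<Rightarrow> nat \<Rightarrow> nat \<Rightarrow> nat" where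
  "eta_T V E a b =
     card {A. subtree V E A \<and> card (inner_edges E A) = a \<and> card (boundary_edges E A) = b}"

definition s_T :: "'a set \<Rightarrow> 'a set set \<Rightarrow> nat \<Rightarrow> nat \<Rightarrow> nat" where
  "s_T V E i j =
     card {A. subtree V E A \<and> card (inner_edges E A) = i \<and> card (leaf_edges E A) = j}"

text \<open>
  The matrix carrying \<open>H1_vec\<close> to \<open>S1_vec\<close> must be allowed half-integers in row \<open>1\<close> when \<open>n\<close> is
  even: then \<open>s_T V E 1 1 = n - 1\<close> is odd, whereas every \<open>eta_T V E 0 b\<close> of a path is even, so an
  integral row is impossible. This is why these two vectors are rational. (Double counting
  gives \<open>2 * s_T V E 1 1 = (\<Sum>b<n. b * eta_T V E 0 b)\<close>.)
\<close>

definition H1_vec :: "nat \<Rightarrow> 'a set \<Rightarrow> 'a set set \<Rightarrow> rat vec" where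
  "H1_vec n V E = vec n (\<lambda>b. of_nat (eta_T V E 0 b))"

definition S1_vec :: "nat \<Rightarrow> 'a set \<Rightarrow> 'a set set \<Rightarrow> rat vec" where
  "S1_vec n V E = vec n (\<lambda>k. of_nat (s_T V E k k))"

definition H2_index :: "nat \<Rightarrow> (nat \<times> nat) set" where
  "H2_index n = {(a, b). 1 \<le> a \<and> 1 \<le> b \<and> a + b \<le> n - 1}"

definition S2_index :: "nat \<Rightarrow> (nat \<times> nat) set" where
  "S2_index n = {(i, j). 2 \<le> j \<and> j \<le> i \<and> i \<le> n - 1}"

definition is_ordering :: "'b list \<Rightarrow> 'b set \<Rightarrow> bool" where
  "is_ordering xs I \<longleftrightarrow> distinct xs \<and> set xs = I"

definition H2_vec :: "(nat \<times> nat) list \<Rightarrow> 'a set \<Rightarrow> 'a set set \<Rightarrow> int vec" where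
  "H2_vec xs V E = vec_of_list (map (\<lambda>(a, b). int (eta_T V E a b)) xs)"

definition S2_vec :: "(nat \<times> nat) list \<Rightarrow> 'a set \<Rightarrow> 'a set set \<Rightarrow> int vec" where
  "S2_vec ys V E = vec_of_list (map (\<lambda>(i, j). int (s_T V E i j)) ys)"

end

(* In a forest, a nonempty vertex set A is connected iff it spans card A - 1 edges, so all graph
   theory below reduces to counting. Attaching k boundary edges to a subtree A with a edges gives a
   subtree S with a + k edges of which k leaf edges are marked, and unless (a, k) = (0, 1) this is
   reversible; hence sum_b C(b,k) eta(a,b) = sum_j C(j,k) s(a+k,j). For a, k >= 1 these relations
   are M and N, block diagonal with blocks of binomial coefficients; for a = 0, k ~= 1 they are the
   rows of P, whose row 1 instead comes from the handshake lemma. A block [C(j,k)] of N, with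
   1 <= k < i and 2 <= j <= i, is nonsingular because sum_k (-1)^k k C(j,k) = 0 for j ~= 1
   annihilates the last coordinate of a kernel vector, after which the block is triangular. *)

theory Submission
  imports Defs
begin

subsection \<open>Counting edges in forests\<close>

definition degree_in :: "'a set set \<Rightarrow> 'a set \<Rightarrow> 'a \<Rightarrow> nat" where
  "degree_in E A v = card {e \<in> inner_edges E A. v \<in> e}"

locale forest =
  fixes V :: "'a set" and E :: "'a set set"
  assumes simple: "simple_graph V E" and no_cycle: "\<not> is_cycle E xs"
begin

lemma finite_V: "finite V"
  using simple by (simp add: simple_graph_def)

lemma edge_subset: "e \<in> E \<Longrightarrow> e \<subseteq> V"
  using simple by (simp add: simple_graph_def)

lemma edge_card: "e \<in> E \<Longrightarrow> card e = 2"
  using simple by (simp add: simple_graph_def)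

lemma edge_other:
  assumes "e \<in> E" "u \<in> e"
  obtains w where "e = {u, w}" "w \<noteq> u"
proof -
  obtain x y where "e = {x, y}" "x \<noteq> y"
    using edge_card[OF assms(1)] by (auto simp: card_2_iff)
  with assms(2) that show thesis by (cases "u = x") auto
qed

lemma finite_E: "finite E"
  using edge_subset finite_V by (meson PowI finite_Pow_iff finite_subset subsetI)

lemma finite_inner: "finite (inner_edges E A)"
  using finite_E by (simp add: inner_edges_def)

lemma finite_boundary: "finite (boundary_edges E A)"
  using finite_E by (simp add: boundary_edges_def)

lemma inner_edges_singleton: "inner_edges E {v} = {}"
proof -
  have "\<not> e \<subseteq> {v}" if "e \<in> E" for e
    using edge_card[OF that] by (auto simp: subset_singleton_iff)
  then show ?thesis by (auto simp: inner_edges_def)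
qed

lemma card_inner_remove:
  "card (inner_edges E (A - {v})) + degree_in E A v = card (inner_edges E A)"
proof -
  have "inner_edges E A = inner_edges E (A - {v}) \<union> {e \<in> inner_edges E A. v \<in> e}"
    by (auto simp: inner_edges_def)
  moreover have "inner_edges E (A - {v}) \<inter> {e \<in> inner_edges E A. v \<in> e} = {}"
    by (auto simp: inner_edges_def)
  ultimately show ?thesis
    unfolding degree_in_def
    by (metis (no_types, lifting) card_Un_disjoint finite_Un finite_inner)
qed

text \<open>A longest path starts at such a vertex, as another edge there would close a cycle.\<close>

lemma exists_low_degree:
  assumes A: "A \<subseteq> V" "A \<noteq> {}"
  shows "\<exists>v\<in>A. degree_in E A v \<le> 1"
proof (rule ccontr)
  assume "\<not> ?thesis"
  then have deg: "degree_in E A v \<ge> 2" if "v \<in> A" for v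
    using that by force
  define path where "path xs \<longleftrightarrow>
    xs \<noteq> [] \<and> set xs \<subseteq> A \<and> distinct xs \<and> successively (\<lambda>x y. {x, y} \<in> E) xs" for xs
  have finA: "finite A"
    using A(1) finite_V by (rule finite_subset)
  obtain a where "a \<in> A" using A(2) by blast
  then have "path [a]" by (simp add: path_def)
  moreover have "\<forall>xs. path xs \<longrightarrow> length xs \<le> card A"
    unfolding path_def using finA by (metis card_mono distinct_card)
  ultimately obtain p where p: "path p" and longest: "\<And>q. path q \<Longrightarrow> length q \<le> length p"
    using ex_has_greatest_nat[of path "[a]" length "Suc (card A)"] by (auto simp: less_Suc_eq_le)
  obtain v ys where pv: "p = v # ys"
    using p unfolding path_def by (cases p) auto
  have vA: "v \<in> A" using p by (simp add: path_def pv)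
  \<comment> \<open>If \<open>p\<close> is just \<open>v\<close>, then \<open>hd ys\<close> is
    unspecified, but degree at least 2 still leaves an edge other than
    \<open>{v, hd ys}\<close>.\<close>
  have "\<exists>e \<in> {e \<in> inner_edges E A. v \<in> e}. e \<noteq> {v, hd ys}"
  proof (rule ccontr)
    assume "\<not> ?thesis"
    then have "{e \<in> inner_edges E A. v \<in> e} \<subseteq> {{v, hd ys}}" by blast
    from card_mono[OF _ this] have "degree_in E A v \<le> 1"
      by (simp add: degree_in_def)
    with deg[OF vA] show False by simp
  qed
  then obtain e where e: "e \<in> E" "e \<subseteq> A" "v \<in> e" "e \<noteq> {v, hd ys}"
    by (auto simp: inner_edges_def)
  obtain w where w: "e = {v, w}" "w \<noteq> v"
    using edge_other[OF e(1,3)] .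
  have "w \<in> set p"
  proof (rule ccontr)
    assume "w \<notin> set p"
    then have "path (w # p)"
      using p e w by (auto simp: path_def pv insert_commute)
    with longest[of "w # p"] show False by simp
  qed
  then obtain i where i: "i < length p" "p ! i = w"
    by (auto simp: in_set_conv_nth)
  \<comment> \<open>Position 0 is \<open>v\<close>, and position 1 would make \<open>e\<close> the
    first edge of the path; so the cycle below has length at least 3.\<close>
  have "i \<noteq> 0" using i w pv by (auto intro: ccontr)
  moreover have "i \<noteq> 1"
    using i w e pv by (auto simp: hd_conv_nth)
  ultimately have i2: "i \<ge> 2" by simp
  have succ: "{p ! j, p ! Suc j} \<in> E" if "Suc j < length p" for j
    using p that unfolding path_def successively_conv_nth by blast
  \<comment> \<open>The cycle is the prefix of \<open>p\<close> up to \<open>w\<close>; at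
    \<open>j = i\<close> the index wraps to 0 and the closing edge is \<open>e\<close>.\<close>
  have "{take (Suc i) p ! j, take (Suc i) p ! (Suc j mod length (take (Suc i) p))} \<in> E"
    if "j < length (take (Suc i) p)" for j
  proof (cases "j = i")
    case True
    have "take (Suc i) p ! i = w" "length (take (Suc i) p) = Suc i"
      using i by auto
    moreover have "take (Suc i) p ! 0 = v" using pv by simp
    ultimately show ?thesis using True e w by (simp add: insert_commute del: take_Suc_Cons)
  next
    case False
    then show ?thesis using that i succ[of j] by simp
  qed
  then have "is_cycle E (take (Suc i) p)"
    using i i2 p unfolding is_cycle_def path_def by simp
  with no_cycle show False by blast
qed

text \<open>Deleting a vertex of degree at most 1 costs one vertex and at most one edge, so the
  bound passes from the smaller set to \<open>A\<close>.\<close>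

lemma card_inner_le:
  assumes "A \<subseteq> V" "A \<noteq> {}"
  shows "card (inner_edges E A) + 1 \<le> card A"
  using assms
proof (induction "card A" arbitrary: A rule: less_induct)
  case less
  have finA: "finite A" using less.prems finite_V by (blast intro: finite_subset)
  obtain v where v: "v \<in> A" "degree_in E A v \<le> 1"
    using exists_low_degree less.prems by blast
  show ?case
  proof (cases "A = {v}")
    case True
    then show ?thesis by (simp add: inner_edges_singleton)
  next
    case False
    have "card (A - {v}) < card A" using finA v(1) by (rule card_Diff1_less)
    moreover have "A - {v} \<noteq> {}" using v False by blast
    ultimately have "card (inner_edges E (A - {v})) + 1 \<le> card (A - {v})"
      using less by blast
    then show ?thesis
      using card_inner_remove[of A v] v finA \<open>card (A - {v}) < card A\<close> by linarith
  qed
qed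

text \<open>A set grown inside \<open>A\<close> from one vertex, one adjacent vertex at a time,
  gains at least one edge per new vertex; connectedness keeps it growing until it is all of
  \<open>A\<close>.\<close>

lemma connected_card_le:
  assumes conn: "induces_connected E A" and A: "A \<subseteq> V"
  shows "card A \<le> card (inner_edges E A) + 1"
proof -
  have finA: "finite A" using A finite_V by (rule finite_subset)
  have "\<exists>B\<subseteq>A. card B = Suc k \<and> Suc k \<le> card (inner_edges E B) + 1" if "Suc k \<le> card A" for k
    using that
  proof (induction k)
    case 0
    then obtain a where "a \<in> A" by fastforce
    then show ?case by (intro exI[of _ "{a}"]) auto
  next
    case (Suc k)
    then obtain B where B: "B \<subseteq> A" "card B = Suc k" "Suc k \<le> card (inner_edges E B) + 1"
      by auto
    have finB: "finite B" using B(1) finA by (rule finite_subset)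
    obtain u where u: "u \<in> B" using B(2) by fastforce
    obtain v where v: "v \<in> A" "v \<notin> B"
      using B Suc.prems by (metis Suc_n_not_le_n subset_antisym subset_iff)
    have "(u, v) \<in> (induced_adj E A)\<^sup>*"
      using conn u v B(1) unfolding induces_connected_def by blast
    \<comment> \<open>A walk from \<open>u\<close> inside \<open>A\<close> that ends outside
      \<open>B\<close> must cross an edge leaving \<open>B\<close>.\<close>
    then have "v \<notin> B \<longrightarrow> (\<exists>x\<in>B. \<exists>y\<in>A - B. {x, y} \<in> E)"
      by (induction rule: rtrancl_induct) (use u in \<open>auto simp: induced_adj_def\<close>)
    with v obtain x y where xy: "x \<in> B" "y \<in> A" "y \<notin> B" "{x, y} \<in> E" by blast
    have "insert {x, y} (inner_edges E B) \<subseteq> inner_edges E (insert y B)"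
      using xy by (auto simp: inner_edges_def)
    moreover have "{x, y} \<notin> inner_edges E B"
      using xy by (auto simp: inner_edges_def)
    ultimately have "card (inner_edges E B) + 1 \<le> card (inner_edges E (insert y B))"
      using finite_inner by (metis Suc_eq_plus1 card_insert_disjoint card_mono)
    then show ?case
      using xy B finB by (intro exI[of _ "insert y B"]) auto
  qed
  moreover have "card A \<noteq> 0"
    using conn finA by (auto simp: induces_connected_def)
  ultimately obtain B where "B \<subseteq> A" "card B = card A" "card A \<le> card (inner_edges E B) + 1"
    by (metis not0_implies_Suc order_refl)
  with finA show ?thesis by (metis card_subset_eq)
qed

text \<open>If \<open>A\<close> were disconnected, no edge would join the component \<open>B\<close>
  of \<open>u\<close> to \<open>A - B\<close>, and the forest bounds for the two pieces would allow
  at most \<open>card A - 2\<close> edges.\<close>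

lemma connected_if_card:
  assumes A: "A \<subseteq> V" "A \<noteq> {}" and card: "card (inner_edges E A) + 1 = card A"
  shows "induces_connected E A"
proof (rule ccontr)
  assume "\<not> ?thesis"
  then obtain u v where uv: "u \<in> A" "v \<in> A" "(u, v) \<notin> (induced_adj E A)\<^sup>*"
    using A(2) by (auto simp: induces_connected_def)
  define B where "B = {w \<in> A. (u, w) \<in> (induced_adj E A)\<^sup>*}"
  have B: "B \<subseteq> A" "u \<in> B" "v \<in> A - B"
    using uv by (auto simp: B_def)
  have finA: "finite A" using A(1) finite_V by (rule finite_subset)
  have step: "y \<in> B" if "x \<in> B" "y \<in> A" "{x, y} \<in> E" for x y
  proof -
    have "(x, y) \<in> induced_adj E A"
      using that B by (auto simp: induced_adj_def)
    with that show ?thesis by (auto simp: B_def intro: rtrancl_into_rtrancl)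
  qed
  have "inner_edges E A \<subseteq> inner_edges E B \<union> inner_edges E (A - B)"
  proof
    fix e assume e: "e \<in> inner_edges E A"
    then obtain x y where xy: "e = {x, y}"
      using edge_card[of e] by (auto simp: inner_edges_def card_2_iff)
    show "e \<in> inner_edges E B \<union> inner_edges E (A - B)"
      using e step[of x y] step[of y x] unfolding xy
      by (auto simp: inner_edges_def insert_commute)
  qed
  then have "card (inner_edges E A) \<le> card (inner_edges E B) + card (inner_edges E (A - B))"
    by (meson card_Un_le card_mono finite_UnI finite_inner le_trans)
  moreover have "card (inner_edges E B) + 1 \<le> card B"
    using B A by (intro card_inner_le) auto
  moreover have "card (inner_edges E (A - B)) + 1 \<le> card (A - B)"
    using B A by (intro card_inner_le) auto
  moreover have "card B + card (A - B) = card A"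
    using B finA by (metis card_Diff_subset card_mono finite_subset le_add_diff_inverse)
  ultimately show False using card by linarith
qed

text \<open>Replaces reachability by a cardinality, so that attaching and detaching edges can be
  checked by counting.\<close>

lemma subtree_iff:
  "subtree V E A \<longleftrightarrow> A \<subseteq> V \<and> A \<noteq> {} \<and> card (inner_edges E A) + 1 = card A"
proof
  assume s: "subtree V E A"
  then have "A \<subseteq> V" "A \<noteq> {}" by (auto simp: subtree_def induces_connected_def)
  with s show "A \<subseteq> V \<and> A \<noteq> {} \<and> card (inner_edges E A) + 1 = card A"
    using card_inner_le[of A] connected_card_le[of A] by (simp add: subtree_def le_antisym)
next
  assume "A \<subseteq> V \<and> A \<noteq> {} \<and> card (inner_edges E A) + 1 = card A"
  then show "subtree V E A" by (simp add: subtree_def connected_if_card)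
qed

lemma finite_subtree: "subtree V E A \<Longrightarrow> finite A"
  using finite_V by (auto simp: subtree_def intro: finite_subset)

lemma finite_subtrees: "finite {A. subtree V E A \<and> P A}"
proof (rule finite_subset)
  show "{A. subtree V E A \<and> P A} \<subseteq> Pow V" by (auto simp: subtree_def)
qed (simp add: finite_V)

section \<open>Degrees, leaves and leaf edges\<close>

lemma handshake:
  assumes "finite A"
  shows "(\<Sum>v\<in>A. degree_in E A v) = 2 * card (inner_edges E A)"
proof -
  have "card {v \<in> A. v \<in> e} = 2" if "e \<in> inner_edges E A" for e
  proof -
    have "{v \<in> A. v \<in> e} = e" using that by (auto simp: inner_edges_def)
    then show ?thesis using that edge_card by (simp add: inner_edges_def)
  qed
  then have "(\<Sum>v\<in>A. card {e \<in> inner_edges E A. v \<in> e}) = 2 * card (inner_edges E A)"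
    using sum_multicount[OF assms finite_inner[of A], of "\<lambda>v e. v \<in> e" 2] by blast
  then show ?thesis by (simp add: degree_in_def)
qed

text \<open>If \<open>v\<close> met no edge, the nonempty set \<open>A - {v}\<close> would have as
  many edges as vertices, against the forest bound.\<close>

lemma degree_pos:
  assumes A: "subtree V E A" and e: "card (inner_edges E A) \<ge> 1" and v: "v \<in> A"
  shows "degree_in E A v \<ge> 1"
proof -
  have card: "card (A - {v}) + 1 = card A"
    using v finite_subtree[OF A] by (metis Suc_eq_plus1 card_Suc_Diff1)
  moreover have AV: "A \<subseteq> V" "card (inner_edges E A) + 1 = card A"
    using A by (auto simp: subtree_iff)
  ultimately have "card (A - {v}) \<noteq> 0" using e by linarith
  then have "A - {v} \<noteq> {}" by force
  then have "card (inner_edges E (A - {v})) + 1 \<le> card (A - {v})"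
    using AV by (intro card_inner_le) auto
  then show ?thesis using card AV card_inner_remove[of A v] by linarith
qed

lemma leaf_edge_exists:
  assumes "is_leaf E A v"
  obtains e where "e \<in> inner_edges E A" "v \<in> e"
proof -
  have "card {e \<in> inner_edges E A. v \<in> e} \<noteq> 0" using assms by (simp add: is_leaf_def)
  then have "{e \<in> inner_edges E A. v \<in> e} \<noteq> {}" by (metis card.empty)
  with that show thesis by blast
qed

lemma leaf_edge_unique:
  assumes "is_leaf E A v" "e \<in> inner_edges E A" "v \<in> e" "e' \<in> inner_edges E A" "v \<in> e'"
  shows "e = e'"
proof -
  have "card {e \<in> inner_edges E A. v \<in> e} = 1" using assms(1) by (simp add: is_leaf_def)
  then obtain d where d: "{e \<in> inner_edges E A. v \<in> e} = {d}" by (rule card_1_singletonE)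
  have "e \<in> {d}" "e' \<in> {d}" unfolding d[symmetric] using assms by simp_all
  then show ?thesis by simp
qed

text \<open>Deleting \<open>u\<close> and \<open>v\<close> loses one edge but two vertices, so a
  nonempty remainder would have at least as many edges as vertices; hence \<open>S\<close> is just
  \<open>{u, v}\<close>.\<close>

lemma two_leaf_edge:
  assumes S: "subtree V E S" and uv: "{u, v} \<in> inner_edges E S" "u \<noteq> v"
    and leaves: "is_leaf E S u" "is_leaf E S v"
  shows "card (inner_edges E S) = 1"
proof -
  have S': "S \<subseteq> V" "card (inner_edges E S) + 1 = card S"
    using S by (auto simp: subtree_iff)
  have uvS: "{u, v} \<subseteq> S" using uv by (simp add: inner_edges_def)
  have only: "e = {u, v}" if "e \<in> inner_edges E S" "u \<in> e \<or> v \<in> e" for e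
    using that leaf_edge_unique[OF leaves(1), of e "{u, v}"]
      leaf_edge_unique[OF leaves(2), of e "{u, v}"] uv(1) by auto
  have "inner_edges E S - {{u, v}} \<subseteq> inner_edges E (S - {u, v})"
  proof
    fix e assume e: "e \<in> inner_edges E S - {{u, v}}"
    then have "\<not> (u \<in> e \<or> v \<in> e)" using only[of e] by blast
    with e show "e \<in> inner_edges E (S - {u, v})" unfolding inner_edges_def by blast
  qed
  then have "card (inner_edges E S) - 1 \<le> card (inner_edges E (S - {u, v}))"
    using uv finite_inner by (metis card_Diff_singleton card_mono)
  moreover have "card (S - {u, v}) = card S - 2"
    using uvS uv(2) finite_subtree[OF S] by (simp add: card_Diff_subset)
  moreover have "card (inner_edges E (S - {u, v})) + 1 \<le> card (S - {u, v})" if "S - {u, v} \<noteq> {}"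
    using S' that by (intro card_inner_le) auto
  moreover have "card (inner_edges E S) \<ge> 1"
    using uv finite_inner by (metis One_nat_def Suc_leI card_gt_0_iff empty_iff)
  ultimately have "\<not> S - {u, v} \<noteq> {}" using S'(2) by linarith
  then have "S = {u, v}" using uvS by blast
  then show ?thesis using S'(2) uv(2) by simp
qed

text \<open>The degrees are positive and sum to \<open>2 * card S - 2\<close>, which forces two
  leaves. An edge shared by them would be the only edge of \<open>S\<close> by
  \<open>two_leaf_edge\<close>.\<close>

lemma card_leaf_edges_ge:
  assumes S: "subtree V E S" and two: "card (inner_edges E S) \<ge> 2"
  shows "card (leaf_edges E S) \<ge> 2"
proof -
  let ?L = "{v \<in> S. degree_in E S v = 1}"
  have finS: "finite S" using S by (rule finite_subtree)
  have "(\<Sum>v\<in>S. 2) \<le> (\<Sum>v\<in>S. degree_in E S v + (if degree_in E S v = 1 then 1 else 0))"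
  proof (rule sum_mono)
    fix v assume "v \<in> S"
    then show "2 \<le> degree_in E S v + (if degree_in E S v = 1 then 1 else 0)"
      using degree_pos[OF S, of v] two by auto
  qed
  also have "\<dots> = 2 * card (inner_edges E S) + card ?L"
    using finS by (simp add: sum.distrib handshake card_eq_sum sum.inter_filter del: sum_constant One_nat_def)
  finally have "card ?L \<ge> 2" using S by (simp add: subtree_iff)
  then obtain u v where uv: "u \<in> ?L" "v \<in> ?L" "u \<noteq> v"
    using card_le_Suc0_iff_eq[of ?L] finS by fastforce
  have leaves: "is_leaf E S u" "is_leaf E S v"
    using uv by (simp_all add: is_leaf_def degree_in_def)
  obtain eu where eu: "eu \<in> inner_edges E S" "u \<in> eu"
    using leaf_edge_exists[OF leaves(1)] .
  obtain ev where ev: "ev \<in> inner_edges E S" "v \<in> ev"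
    using leaf_edge_exists[OF leaves(2)] .
  have "eu \<noteq> ev"
  proof
    assume "eu = ev"
    then have v: "v \<in> eu" using ev by simp
    have "eu \<in> E" using eu by (simp add: inner_edges_def)
    then obtain w where "eu = {u, w}" using edge_other eu(2) by blast
    with v uv(3) have "eu = {u, v}" by auto
    with eu two_leaf_edge[OF S _ uv(3) leaves] two show False by simp
  qed
  moreover have "{eu, ev} \<subseteq> leaf_edges E S"
    using leaves eu ev by (auto simp: leaf_edges_def)
  moreover have "finite (leaf_edges E S)" by (simp add: leaf_edges_def finite_inner)
  ultimately have "card {eu, ev} \<le> card (leaf_edges E S)" by (intro card_mono)
  with \<open>eu \<noteq> ev\<close> show ?thesis by simp
qed

subsection \<open>Attaching leaf edges\<close>

lemma boundary_edge:
  assumes "e \<in> boundary_edges E A"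
  shows "card (e - A) = 1" "card (e \<inter> A) = 1" "e \<in> E"
proof -
  have e: "e \<in> E" "card (e \<inter> A) = 1" using assms by (auto simp: boundary_edges_def)
  then show "e \<in> E" "card (e \<inter> A) = 1" by auto
  have "finite e" using edge_card[OF e(1)] by (metis card.infinite zero_neq_numeral)
  then show "card (e - A) = 1"
    using e edge_card[OF e(1)] by (simp add: card_Diff_subset_Int)
qed

text \<open>Each edge of \<open>F\<close> adds one edge and at most one vertex, while a forest has
  fewer edges than vertices. So the outer endpoints are distinct and no further edge arises in the
  union.\<close>

lemma attach:
  assumes A: "subtree V E A" and F: "F \<subseteq> boundary_edges E A"
  defines "S \<equiv> A \<union> \<Union>F"
  shows "subtree V E S"
    and "inner_edges E S = inner_edges E A \<union> F"
    and "card (inner_edges E S) = card (inner_edges E A) + card F"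
    and "\<And>w e. e \<in> F \<Longrightarrow> w \<in> e \<Longrightarrow> w \<notin> A \<Longrightarrow> is_leaf E S w"
proof -
  define out where "out e = the_elem (e - A)" for e
  have out: "e - A = {out e}" if "e \<in> F" for e
    using boundary_edge(1)[of e A] F that unfolding out_def
    by (metis card_1_singletonE subsetD the_elem_eq)
  have finF: "finite F" using F finite_boundary by (rule finite_subset)
  have FE: "F \<subseteq> E" using F boundary_edge(3) by blast
  have SA: "S - A = out ` F" using out by (auto simp: S_def)
  have A': "A \<subseteq> V" "A \<noteq> {}" "card (inner_edges E A) + 1 = card A"
    using A by (auto simp: subtree_iff)
  have S': "S \<subseteq> V" "S \<noteq> {}" using A' FE edge_subset by (auto simp: S_def)
  have finS: "finite S" using S'(1) finite_V by (rule finite_subset)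
  have sub: "inner_edges E A \<union> F \<subseteq> inner_edges E S"
    using FE by (auto simp: inner_edges_def S_def)
  have disj: "inner_edges E A \<inter> F = {}"
    using out by (auto simp: inner_edges_def)
  have cun: "card (inner_edges E A \<union> F) = card (inner_edges E A) + card F"
    using disj finF finite_inner by (simp add: card_Un_disjoint)
  have le1: "card (inner_edges E A) + card F \<le> card (inner_edges E S)"
    using sub finite_inner cun by (metis card_mono)
  have le2: "card (inner_edges E S) + 1 \<le> card S"
    using S' by (rule card_inner_le)
  have "card S = card A + card (S - A)"
    using finS by (simp add: S_def card_Un_disjoint[symmetric] Un_Diff_cancel Diff_disjoint)
  moreover have le3: "card (out ` F) \<le> card F" using finF by (rule card_image_le)
  \<comment> \<open>With e counting inner edges, e(A) + |F| \<le> e(S) \<le> |S| - 1 \<le> e(A) +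
    |F|, so equality holds throughout, also in \<open>le3\<close>.\<close>
  ultimately have eqs: "card (out ` F) = card F" "card (inner_edges E S) + 1 = card S"
    "card (inner_edges E S) = card (inner_edges E A) + card F"
    using le1 le2 A' SA by auto
  show "subtree V E S" using S' eqs by (simp add: subtree_iff)
  show "card (inner_edges E S) = card (inner_edges E A) + card F" by fact
  show inner: "inner_edges E S = inner_edges E A \<union> F"
    using sub finite_inner cun eqs by (metis card_subset_eq)
  have inj: "inj_on out F" using finF eqs(1) by (rule eq_card_imp_inj_on)
  show "is_leaf E S w" if "e \<in> F" "w \<in> e" "w \<notin> A" for w e
  proof -
    have "{e' \<in> inner_edges E S. w \<in> e'} = {e}"
    proof (intro equalityI subsetI)
      fix e' assume "e' \<in> {e' \<in> inner_edges E S. w \<in> e'}"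
      then have "e' \<in> F" "w \<in> e'" using inner that by (auto simp: inner_edges_def)
      then have "w \<in> {out e'}" "w \<in> {out e}"
        using out[of e'] out[of e] that by blast+
      then have "out e' = out e" by simp
      then show "e' \<in> {e}" using inj that \<open>e' \<in> F\<close> by (simp add: inj_on_eq_iff)
    qed (use that inner in auto)
    then show ?thesis using that by (auto simp: is_leaf_def S_def)
  qed
qed

lemma attach_leaf_edges:
  assumes A: "subtree V E A" and F: "F \<subseteq> boundary_edges E A"
  shows "F \<subseteq> leaf_edges E (A \<union> \<Union>F)"
proof
  fix e assume e: "e \<in> F"
  then have "card (e - A) = 1" using F boundary_edge by blast
  then obtain w where "w \<in> e" "w \<notin> A" by (metis DiffE card_1_singletonE insertI1)
  with attach[OF A F] e show "e \<in> leaf_edges E (A \<union> \<Union>F)"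
    by (auto simp: leaf_edges_def)
qed

text \<open>Delete one leaf of every edge in \<open>F\<close>. A leaf lies on a single edge, so
  exactly the edges of \<open>F\<close> disappear, one vertex each.\<close>

lemma detach:
  assumes S: "subtree V E S" and F: "F \<subseteq> leaf_edges E S"
    and cardF: "card (inner_edges E S) = a + card F"
  obtains A where "subtree V E A" "card (inner_edges E A) = a"
    "F \<subseteq> boundary_edges E A" "S = A \<union> \<Union>F"
proof -
  have Fin: "F \<subseteq> inner_edges E S" using F by (auto simp: leaf_edges_def)
  have finF: "finite F" using Fin finite_inner by (rule finite_subset)
  have S': "S \<subseteq> V" "card (inner_edges E S) + 1 = card S"
    using S by (auto simp: subtree_iff)
  have finS: "finite S" using S by (rule finite_subtree)
  have "\<forall>e\<in>F. \<exists>v. v \<in> e \<and> is_leaf E S v"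
    using F by (auto simp: leaf_edges_def)
  \<comment> \<open>If \<open>S\<close> is a single edge, both endpoints qualify and either choice
    will do.\<close>
  then obtain l where l: "\<And>e. e \<in> F \<Longrightarrow> l e \<in> e \<and> is_leaf E S (l e)"
    by metis
  have uniq: "e = e'" if "e' \<in> F" "l e' \<in> e" "e \<in> inner_edges E S" for e e'
    using leaf_edge_unique[of S "l e'" e e'] that l[OF that(1)] Fin by blast
  have inj: "inj_on l F"
    using uniq l Fin by (metis inj_onI subset_iff)
  define A where "A = S - l ` F"
  have "l ` F \<subseteq> S" using l by (auto simp: is_leaf_def)
  then have cardA: "card A = a + 1"
    using S' cardF inj finF finS
    by (simp add: A_def card_Diff_subset card_image)
  have inner: "inner_edges E A = inner_edges E S - F"
  proof (intro equalityI subsetI)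
    fix e assume "e \<in> inner_edges E A"
    then show "e \<in> inner_edges E S - F"
      using l by (auto simp: inner_edges_def A_def)
  next
    fix e assume e: "e \<in> inner_edges E S - F"
    then have "x \<notin> l ` F" if "x \<in> e" for x
      using uniq that by blast
    then show "e \<in> inner_edges E A" using e by (auto simp: inner_edges_def A_def)
  qed
  have cin: "card (inner_edges E A) = a"
    using inner Fin finF cardF by (simp add: card_Diff_subset)
  show thesis
  proof
    have "A \<noteq> {}" using cardA by force
    then show "subtree V E A"
      using cin cardA S'(1) by (auto simp: subtree_iff A_def)
    show "card (inner_edges E A) = a" by (fact cin)
    have eA: "e - A = {l e}" "\<exists>u. e \<inter> A = {u}" if "e \<in> F" for e
    proof -
      have eS: "e \<in> inner_edges E S" "e \<in> E" "e \<subseteq> S"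
        using that Fin by (auto simp: inner_edges_def)
      obtain u where u: "e = {l e, u}" "u \<noteq> l e"
        using edge_other[OF eS(2), of "l e"] l[OF \<open>e \<in> F\<close>] by auto
      have "u \<notin> l ` F"
      proof
        assume "u \<in> l ` F"
        then obtain e' where "e' \<in> F" "u = l e'" by blast
        with uniq[of e' e] eS u show False by blast
      qed
      then have "u \<in> A" "l e \<notin> A" using u eS that by (auto simp: A_def)
      moreover have "x \<in> e \<longleftrightarrow> x = l e \<or> x = u" for x
        by (subst u(1)) simp
      ultimately have "e - A = {l e}" "e \<inter> A = {u}" by auto
      then show "e - A = {l e}" "\<exists>u. e \<inter> A = {u}" by blast+
    qed
    show "F \<subseteq> boundary_edges E A"
    proof
      fix e assume e: "e \<in> F"
      then have "card (e \<inter> A) = 1" using eA(2) by fastforce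
      with e Fin show "e \<in> boundary_edges E A"
        by (auto simp: boundary_edges_def inner_edges_def)
    qed
    have "\<Union>F \<subseteq> S" using Fin by (auto simp: inner_edges_def)
    then show "S = A \<union> \<Union>F" using l by (auto simp: A_def)
  qed
qed

text \<open>Outside the case of a single edge, only one endpoint of a leaf edge is a leaf, so the
  smaller subtree is recovered from the larger one and the attached edges.\<close>

lemma attach_inj:
  assumes A: "subtree V E A" "F \<subseteq> boundary_edges E A"
    and B: "subtree V E B" "F \<subseteq> boundary_edges E B"
    and eq: "A \<union> \<Union>F = B \<union> \<Union>F"
    and ne: "card (inner_edges E A) + card F \<noteq> 1 \<or> F = {}"
  shows "A \<subseteq> B"
proof
  fix u assume u: "u \<in> A"
  let ?S = "A \<union> \<Union>F"
  show "u \<in> B"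
  proof (rule ccontr)
    assume "u \<notin> B"
    then obtain e where e: "e \<in> F" "u \<in> e" using u eq by blast
    \<comment> \<open>\<open>e\<close> attaches \<open>u\<close> to \<open>B\<close>, and below it
      attaches the other endpoint \<open>v\<close> to \<open>A\<close>. So both ends of
      \<open>e\<close> are leaves of the union, which must then be a single edge.\<close>
    have leafu: "is_leaf E ?S u"
      using attach(4)[OF B e \<open>u \<notin> B\<close>] eq by simp
    have "card (e - A) = 1" using e A(2) boundary_edge by blast
    then obtain v where v: "v \<in> e" "v \<notin> A" by (metis DiffE card_1_singletonE insertI1)
    have "e = {u, v}" "u \<noteq> v"
      using edge_other[of e u] e v u A(2) boundary_edge(3) by blast+
    moreover have "e \<in> inner_edges E ?S" using attach(2)[OF A] e by simp
    ultimately have "card (inner_edges E ?S) = 1"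
      using two_leaf_edge[OF attach(1)[OF A]] leafu attach(4)[OF A e(1) v] by simp
    then show False using ne attach(3)[OF A] e by auto
  qed
qed

text \<open>Both sides count the pairs of a subtree with \<open>a\<close> edges and \<open>k\<close> of its boundary edges.\<close>

lemma sum_choose_boundary_eq:
  assumes ak: "(a, k) \<noteq> (0, 1)"
  shows "(\<Sum>A | subtree V E A \<and> card (inner_edges E A) = a. card (boundary_edges E A) choose k)
    = (\<Sum>S | subtree V E S \<and> card (inner_edges E S) = a + k. card (leaf_edges E S) choose k)"
    (is "?l = ?r")
proof -
  let ?X = "\<lambda>a. {A. subtree V E A \<and> card (inner_edges E A) = a}"
  let ?P = "SIGMA A : ?X a. {F. F \<subseteq> boundary_edges E A \<and> card F = k}"
  let ?Q = "SIGMA S : ?X (a + k). {F. F \<subseteq> leaf_edges E S \<and> card F = k}"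
  let ?f = "\<lambda>(A, F). (A \<union> \<Union>F, F)"
  have finl: "finite (leaf_edges E S)" for S by (simp add: leaf_edges_def finite_inner)
  have "?l = card ?P"
    by (subst card_SigmaI) (auto simp: finite_subtrees finite_boundary n_subsets)
  also have "card ?P = card ?Q"
  proof (rule bij_betw_same_card[of ?f], unfold bij_betw_def, intro conjI)
    show "inj_on ?f ?P"
    proof (rule inj_onI, clarsimp)
      fix A B F
      assume AB: "subtree V E A" "F \<subseteq> boundary_edges E A" "subtree V E B"
        "F \<subseteq> boundary_edges E B" "A \<union> \<Union>F = B \<union> \<Union>F"
        and a: "a = card (inner_edges E A)" "card (inner_edges E B) = card (inner_edges E A)"
        and k: "k = card F"
      have "finite F" using AB(2) finite_boundary by (rule finite_subset)
      then have "F = {} \<or> card F \<noteq> 0" by auto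
      \<comment> \<open>Total 1 with \<open>F\<close> nonempty would mean \<open>a = 0\<close> and
        \<open>k = 1\<close>.\<close>
      then have ne: "card (inner_edges E A) + card F \<noteq> 1 \<or> F = {}"
        using ak a k by (auto simp: add_eq_if split: if_splits)
      show "A = B"
        using attach_inj[OF AB ne] attach_inj[OF AB(3,4,1,2)] AB(5) ne a(2) by auto
    qed
    show "?f ` ?P = ?Q"
    proof (intro equalityI subsetI)
      fix x assume "x \<in> ?f ` ?P"
      then show "x \<in> ?Q"
        using attach(1,3) attach_leaf_edges by force
    next
      fix x assume "x \<in> ?Q"
      then obtain S F where x: "x = (S, F)" "subtree V E S" "card (inner_edges E S) = a + card F"
        "F \<subseteq> leaf_edges E S" "card F = k" by auto
      obtain A where "subtree V E A" "card (inner_edges E A) = a"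
        "F \<subseteq> boundary_edges E A" "S = A \<union> \<Union>F"
        using detach[OF x(2,4,3)] .
      then show "x \<in> ?f ` ?P"
        using x by (intro image_eqI[of _ _ "(A, F)"]) auto
    qed
  qed
  also have "card ?Q = ?r"
    by (subst card_SigmaI) (auto simp: finite_subtrees finl n_subsets)
  finally show ?thesis .
qed

section \<open>Linear relations between the counts\<close>

lemma card_inner_boundary:
  assumes "subtree V E A"
  shows "card (inner_edges E A) + card (boundary_edges E A) + 1 \<le> card V"
proof -
  \<comment> \<open>All boundary edges are attached at once; the resulting subtree still fits into
    \<open>V\<close>.\<close>
  let ?S = "A \<union> \<Union>(boundary_edges E A)"
  have "subtree V E ?S" and *: "card (inner_edges E ?S) = card (inner_edges E A) + card (boundary_edges E A)"
    using attach[OF assms order_refl] by auto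
  then have "card ?S = card (inner_edges E ?S) + 1" "?S \<subseteq> V" by (auto simp: subtree_iff)
  with * show ?thesis using finite_V card_mono by metis
qed

lemma card_leaf_inner: "card (leaf_edges E A) \<le> card (inner_edges E A)"
  by (rule card_mono) (auto simp: finite_inner leaf_edges_def)

lemma card_inner_less:
  assumes "subtree V E A"
  shows "card (inner_edges E A) < card V"
  using card_inner_boundary[OF assms] by simp

text \<open>The range of \<open>b\<close> loses nothing by \<open>card_inner_boundary\<close>. The
  coefficients lie in a general semiring to serve both the rational relations for \<open>P\<close>
  and the integer ones for \<open>M\<close> and \<open>N\<close>.\<close>

lemma sum_eta:
  fixes f :: "nat \<Rightarrow> 'b :: comm_semiring_1"
  shows "(\<Sum>b<card V. f b * of_nat (eta_T V E a b))
    = (\<Sum>A | subtree V E A \<and> card (inner_edges E A) = a. f (card (boundary_edges E A)))"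
proof -
  let ?X = "{A. subtree V E A \<and> card (inner_edges E A) = a}"
  have "(\<lambda>A. card (boundary_edges E A)) ` ?X \<subseteq> {..<card V}"
    using card_inner_boundary by fastforce
  then show ?thesis
    by (subst sum_fun_comp[of _ "{..<card V}"])
      (simp_all add: finite_subtrees eta_T_def mult.commute)
qed

lemma sum_s:
  fixes f :: "nat \<Rightarrow> 'b :: comm_semiring_1"
  shows "(\<Sum>j<card V. f j * of_nat (s_T V E i j))
    = (\<Sum>S | subtree V E S \<and> card (inner_edges E S) = i. f (card (leaf_edges E S)))"
proof -
  let ?X = "{S. subtree V E S \<and> card (inner_edges E S) = i}"
  have "(\<lambda>S. card (leaf_edges E S)) ` ?X \<subseteq> {..<card V}"
    using card_inner_less card_leaf_inner by (auto intro: le_less_trans)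
  then show ?thesis
    by (subst sum_fun_comp[of _ "{..<card V}"])
      (simp_all add: finite_subtrees s_T_def mult.commute)
qed

lemma eta_eq_s:
  assumes "(a, k) \<noteq> (0, 1)"
  shows "(\<Sum>b<card V. of_nat (b choose k) * of_nat (eta_T V E a b))
    = (\<Sum>j<card V. of_nat (j choose k) * (of_nat (s_T V E (a + k) j) :: 'b :: comm_semiring_1))"
  unfolding sum_eta sum_s of_nat_sum[symmetric] using sum_choose_boundary_eq[OF assms] by simp

lemma eta_eq_0:
  assumes "card V \<le> a + b"
  shows "eta_T V E a b = 0"
proof -
  have "{A. subtree V E A \<and> card (inner_edges E A) = a \<and> card (boundary_edges E A) = b} = {}"
    using card_inner_boundary assms by force
  then show ?thesis unfolding eta_T_def by (metis card.empty)
qed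

text \<open>Leaf edges are edges, and two or more edges force two or more leaf edges.\<close>

lemma s_eq_0:
  assumes "i < j \<or> 2 \<le> i \<and> j < 2"
  shows "s_T V E i j = 0"
proof -
  have "{S. subtree V E S \<and> card (inner_edges E S) = i \<and> card (leaf_edges E S) = j} = {}"
    using card_leaf_edges_ge card_leaf_inner assms by (auto simp: not_le[symmetric])
  then show ?thesis unfolding s_T_def by (metis card.empty)
qed

text \<open>A subtree with one edge has two vertices, so it is an edge of the graph; both of its
  leaves lie on that same edge, which is therefore its only leaf edge.\<close>

lemma s_1_1: "s_T V E 1 1 = card E"
proof -
  have "{A. subtree V E A \<and> card (inner_edges E A) = 1 \<and> card (leaf_edges E A) = 1} = E"
    (is "?X = E")
  proof (intro equalityI subsetI)
    fix A assume "A \<in> ?X"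
    then have A: "subtree V E A" "card (inner_edges E A) = 1" by auto
    then obtain e where "inner_edges E A = {e}" by (metis card_1_singletonE)
    then have e: "e \<in> E" "e \<subseteq> A" by (auto simp: inner_edges_def)
    moreover have "card A = 2" using A by (simp add: subtree_iff)
    ultimately have "e = A" using edge_card finite_subtree[OF A(1)] by (metis card_subset_eq)
    with e show "A \<in> E" by simp
  next
    fix A assume A: "A \<in> E"
    have c: "card A = 2" using A by (rule edge_card)
    then have finA: "finite A" by (metis card.infinite zero_neq_numeral)
    have inner: "inner_edges E A = {A}"
      using A edge_card c card_subset_eq[OF finA] by (auto simp: inner_edges_def)
    then have "leaf_edges E A = {A}"
      using c by (auto simp: leaf_edges_def is_leaf_def Collect_conv_if card_2_iff)
    with inner c A edge_subset show "A \<in> ?X" by (auto simp: subtree_iff)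
  qed
  then show ?thesis by (simp add: s_T_def)
qed

end

section \<open>Vertices and degrees in a tree\<close>

locale finite_tree = forest +
  assumes connected: "induces_connected E V"
begin

lemma inner_edges_V: "inner_edges E V = E"
  using edge_subset by (auto simp: inner_edges_def)

lemma subtree_V: "subtree V E V"
  using connected by (simp add: subtree_def)

lemma card_E: "card E + 1 = card V"
  using subtree_V by (simp add: subtree_iff inner_edges_V)

text \<open>An edgeless subtree is a single vertex, and its boundary edges are all the edges at that
  vertex.\<close>

lemma sum_single_vertices:
  "(\<Sum>A | subtree V E A \<and> card (inner_edges E A) = 0. f (card (boundary_edges E A)))
    = (\<Sum>v\<in>V. f (degree_in E V v))"
proof -
  have "{A. subtree V E A \<and> card (inner_edges E A) = 0} = (\<lambda>v. {v}) ` V"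
  proof (intro equalityI subsetI)
    fix A assume "A \<in> {A. subtree V E A \<and> card (inner_edges E A) = 0}"
    then have "card A = 1" "A \<subseteq> V" by (auto simp: subtree_iff)
    moreover from this(1) obtain v where "A = {v}" by (rule card_1_singletonE)
    ultimately show "A \<in> (\<lambda>v. {v}) ` V" by blast
  qed (auto simp: subtree_iff inner_edges_singleton)
  moreover have "boundary_edges E {v} = {e \<in> inner_edges E V. v \<in> e}" for v
    by (auto simp: boundary_edges_def inner_edges_V Int_insert_right)
  ultimately show ?thesis
    by (simp add: sum.reindex degree_in_def)
qed

text \<open>The coefficients come from \<open>(\<Sum>v\<in>V. 2 - degree v) = 2\<close>. The entry at \<open>b = 0\<close> is free, as no vertex is
  isolated; the value \<open>0\<close> keeps the matrix triangular.\<close>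

lemma eta_row_1:
  assumes n: "card V \<ge> 2"
  shows "(\<Sum>b<card V. (if b = 0 then 0 else of_nat (card V - 1) * (2 - of_nat b) / 2)
      * of_nat (eta_T V E 0 b)) = (of_nat (s_T V E 1 1) :: rat)"
proof -
  have deg: "degree_in E V v \<noteq> 0" if "v \<in> V" for v
    using degree_pos[OF subtree_V _ that] n card_E by (simp add: inner_edges_V)
  have hs: "(\<Sum>v\<in>V. of_nat (degree_in E V v)) = (2 * of_nat (card E) :: rat)"
    using handshake[OF finite_V] unfolding inner_edges_V of_nat_sum[symmetric] by simp
  have "(\<Sum>v\<in>V. if degree_in E V v = 0 then 0 else
      of_nat (card V - 1) * (2 - of_nat (degree_in E V v)) / 2)
    = (\<Sum>v\<in>V. of_nat (card E) / 2 * (2 - of_nat (degree_in E V v)) :: rat)"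
  proof (rule sum.cong)
    fix v assume "v \<in> V"
    moreover have "card V - 1 = card E" using card_E by simp
    ultimately show "(if degree_in E V v = 0 then 0 else
        of_nat (card V - 1) * (2 - of_nat (degree_in E V v)) / 2)
      = (of_nat (card E) / 2 * (2 - of_nat (degree_in E V v)) :: rat)"
      using deg[OF \<open>v \<in> V\<close>] by simp
  qed simp
  also have "\<dots> = of_nat (card E) / 2 * (2 * of_nat (card V) - 2 * of_nat (card E))"
    unfolding sum_distrib_left[symmetric] by (simp add: sum_subtractf hs mult.commute)
  also have "\<dots> = of_nat (card E)"
    using card_E by (simp add: card_E[symmetric])
  finally show ?thesis
    unfolding sum_eta s_1_1
    by (rule trans[OF sum_single_vertices[of "\<lambda>d. if d = 0 then 0 else
      of_nat (card V - 1) * (2 - of_nat d) / 2 :: rat"]])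
qed

end

subsection \<open>Nonsingularity\<close>

text \<open>Equation \<open>k\<close> involves only unknowns of index at least \<open>k\<close>,
  with coefficient 1 at \<open>k\<close>; back substitution starts at \<open>m\<close>.\<close>

lemma choose_triangular_kernel:
  fixes f :: "nat \<Rightarrow> int"
  assumes zero: "\<And>k. 1 \<le> k \<Longrightarrow> k \<le> m \<Longrightarrow> (\<Sum>b=1..m. int (b choose k) * f b) = 0"
    and "1 \<le> b" "b \<le> m"
  shows "f b = 0"
  using assms(2,3)
proof (induction "m - b" arbitrary: b rule: less_induct)
  case less
  have "int (j choose b) * f j = 0" if "j \<in> {1..m} - {b}" for j
  proof (cases "j < b")
    case False
    with that less.prems have "f j = 0" by (intro less.hyps) auto
    then show ?thesis by simp
  qed (simp add: binomial_eq_0)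
  then have "(\<Sum>j=1..m. int (j choose b) * f j) = (\<Sum>j\<in>{b}. int (j choose b) * f j)"
    using less.prems by (intro sum.mono_neutral_right) auto
  with zero less.prems show ?case by simp
qed

text \<open>Rows \<open>1..i-1\<close> against columns \<open>2..i\<close> are not triangular. An
  alternating combination yields \<open>f i = 0\<close>, which is the missing row \<open>i\<close>;
  a zero unknown in column 1 then makes the system triangular.\<close>

lemma choose_shifted_kernel:
  fixes f :: "nat \<Rightarrow> int"
  assumes i: "2 \<le> i"
    and zero: "\<And>k. 1 \<le> k \<Longrightarrow> k < i \<Longrightarrow> (\<Sum>j=2..i. int (j choose k) * f j) = 0"
    and j: "2 \<le> j" "j \<le> i"
  shows "f j = 0"
proof -
  have top: "(\<Sum>j=2..i. int (j choose i) * f j) = f i"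
  proof -
    have "(\<Sum>j=2..i. int (j choose i) * f j) = (\<Sum>j\<in>{i}. int (j choose i) * f j)"
      using i by (intro sum.mono_neutral_right) (auto simp: binomial_eq_0)
    then show ?thesis by simp
  qed
  have alt: "(\<Sum>k\<le>i. (-1) ^ k * int k * int (j choose k)) = 0" if "j \<in> {2..i}" for j
  proof -
    have "(\<Sum>k\<le>i. (-1) ^ k * int k * int (j choose k)) = (\<Sum>k\<le>j. (-1) ^ k * int k * int (j choose k))"
      using that by (intro sum.mono_neutral_right) (auto simp: binomial_eq_0)
    also have "\<dots> = 0" using that by (intro choose_alternating_linear_sum) auto
    finally show ?thesis .
  qed
  \<comment> \<open>Row \<open>k\<close> is weighted by \<open>(-1) ^ k * k\<close>. Every column
    cancels by \<open>alt\<close>, rows \<open>1..i-1\<close> vanish by assumption and row 0 has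
    weight 0, so only row \<open>i\<close> remains.\<close>
  have "0 = (\<Sum>j=2..i. (\<Sum>k\<le>i. (-1) ^ k * int k * int (j choose k)) * f j)"
    using alt by simp
  also have "\<dots> = (\<Sum>k\<le>i. (-1) ^ k * int k * (\<Sum>j=2..i. int (j choose k) * f j))"
    unfolding sum_distrib_left sum_distrib_right by (subst sum.swap) (simp add: mult.assoc)
  also have "\<dots> = (\<Sum>k\<in>{i}. (-1) ^ k * int k * (\<Sum>j=2..i. int (j choose k) * f j))"
  proof (rule sum.mono_neutral_right)
    show "\<forall>k\<in>{..i} - {i}. (-1) ^ k * int k * (\<Sum>j=2..i. int (j choose k) * f j) = 0"
    proof
      fix k assume "k \<in> {..i} - {i}"
      then show "(-1) ^ k * int k * (\<Sum>j=2..i. int (j choose k) * f j) = 0"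
        using zero[of k] by (cases "k = 0") auto
    qed
  qed auto
  finally have fi: "f i = 0" using i top by simp
  define g where "g j = (if j = 1 then 0 else f j)" for j
  have "(\<Sum>j=1..i. int (j choose k) * g j) = 0" if "1 \<le> k" "k \<le> i" for k
  proof -
    have "(\<Sum>j=1..i. int (j choose k) * g j) = (\<Sum>j=2..i. int (j choose k) * g j)"
      by (intro sum.mono_neutral_right) (auto simp: g_def)
    also have "\<dots> = (\<Sum>j=2..i. int (j choose k) * f j)"
      by (intro sum.cong) (auto simp: g_def)
    also have "\<dots> = 0" using zero[of k] that top fi by (cases "k = i") auto
    finally show ?thesis .
  qed
  from choose_triangular_kernel[of i g j, OF this] j show ?thesis by (simp add: g_def)
qed

text \<open>Row \<open>(a, k)\<close> meets only columns with first coordinate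
  \<open>r (a, k)\<close>. Taking \<open>r\<close> to be \<open>fst\<close> gives \<open>M\<close>;
  taking the coordinate sum gives \<open>N\<close>.\<close>

definition block_mat :: "(nat \<times> nat \<Rightarrow> nat) \<Rightarrow> (nat \<times> nat) list \<Rightarrow> (nat \<times> nat) list \<Rightarrow> int mat" where
  "block_mat r zs ws = mat (length zs) (length ws) (\<lambda>(p, q).
     if fst (ws ! q) = r (zs ! p) then int (snd (ws ! q) choose snd (zs ! p)) else 0)"

lemma block_mat_carrier: "block_mat r zs ws \<in> carrier_mat (length zs) (length ws)"
  by (simp add: block_mat_def)

lemma block_mat_mult:
  assumes "distinct ws" "p < length zs"
  shows "(block_mat r zs ws *\<^sub>v vec_of_list (map h ws)) $ p
    = (\<Sum>c | (r (zs ! p), c) \<in> set ws. int (c choose snd (zs ! p)) * h (r (zs ! p), c))"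
proof -
  let ?g = "\<lambda>y. if fst y = r (zs ! p) then int (snd y choose snd (zs ! p)) * h y else 0"
  have "(block_mat r zs ws *\<^sub>v vec_of_list (map h ws)) $ p = (\<Sum>q<length ws. ?g (ws ! q))"
    using assms(2)
    by (auto simp: block_mat_def scalar_prod_def lessThan_atLeast0 vec_of_list_index intro!: sum.cong)
  also have "\<dots> = (\<Sum>y\<in>set ws. ?g y)"
    using assms(1) by (intro sum.reindex_bij_betw bij_betw_nth) auto
  also have "\<dots> = (\<Sum>y\<in>{y \<in> set ws. fst y = r (zs ! p)}. int (snd y choose snd (zs ! p)) * h y)"
    by (simp add: sum.inter_filter)
  also have "{y \<in> set ws. fst y = r (zs ! p)} = Pair (r (zs ! p)) ` {c. (r (zs ! p), c) \<in> set ws}"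
    by auto
  finally show ?thesis by (simp add: sum.reindex inj_on_def)
qed

text \<open>Reduces nonsingularity to a kernel condition on functions of index pairs, slice by
  slice, where the orderings no longer matter.\<close>

lemma det_block_mat:
  assumes "distinct ws" "length zs = length ws"
    and ker: "\<And>h. (\<And>x. x \<in> set zs \<Longrightarrow> (\<Sum>c | (r x, c) \<in> set ws. int (c choose snd x) * h (r x, c)) = 0)
      \<Longrightarrow> \<forall>y\<in>set ws. h y = 0"
  shows "det (block_mat r zs ws) \<noteq> 0"
proof
  let ?A = "block_mat r zs ws"
  have "?A \<in> carrier_mat (length ws) (length ws)"
    using block_mat_carrier[of r zs ws] assms(2) by simp
  moreover assume "det ?A = 0"
  ultimately obtain v where v: "v \<in> carrier_vec (length ws)" "v \<noteq> 0\<^sub>v (length ws)"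
      "?A *\<^sub>v v = 0\<^sub>v (length ws)"
    using det_0_iff_vec_prod_zero by blast
  \<comment> \<open>As \<open>ws\<close> is distinct, a position can be recovered from its index
    pair, so \<open>v\<close> becomes a function on pairs.\<close>
  define h where "h y = v $ (the_inv_into {..<length ws} ((!) ws) y)" for y
  have h: "h (ws ! q) = v $ q" if "q < length ws" for q
    using that assms(1) by (simp add: h_def the_inv_into_f_f inj_on_nth)
  have vh: "v = vec_of_list (map h ws)"
    using v(1) h by (intro eq_vecI) (auto simp: vec_of_list_index)
  have "\<forall>y\<in>set ws. h y = 0"
  proof (rule ker)
    fix x assume "x \<in> set zs"
    then obtain p where p: "p < length zs" "x = zs ! p" by (auto simp: in_set_conv_nth)
    then have "(?A *\<^sub>v vec_of_list (map h ws)) $ p = 0"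
      using v(3) assms(2) unfolding vh[symmetric] by simp
    then show "(\<Sum>c | (r x, c) \<in> set ws. int (c choose snd x) * h (r x, c)) = 0"
      using block_mat_mult[OF assms(1) p(1)] p(2) by simp
  qed
  then have "v = 0\<^sub>v (length ws)"
    using v(1) h by (intro eq_vecI) auto
  with v(2) show False by simp
qed

section \<open>Index sets and the determinants of the block matrices\<close>

lemma finite_S2_index: "finite (S2_index n)"
  by (rule finite_subset[of _ "{..n} \<times> {..n}"]) (auto simp: S2_index_def)

text \<open>Passing from \<open>n\<close> to \<open>Suc n\<close> adds the row \<open>i = n\<close>
  with its \<open>n - 1\<close> values of \<open>j\<close>, as in Pascal's rule.\<close>

lemma card_S2_index: "card (S2_index n) = (n - 1) choose 2"
proof (induction n)
  case 0
  have "S2_index 0 = {}" by (auto simp: S2_index_def)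
  then show ?case by simp
next
  case (Suc n)
  have "S2_index (Suc n) = S2_index n \<union> {n} \<times> {2..n}"
    by (auto simp: S2_index_def)
  moreover have "S2_index n \<inter> {n} \<times> {2..n} = {}"
    by (auto simp: S2_index_def)
  ultimately have "card (S2_index (Suc n)) = ((n - 1) choose 2) + (n - 1)"
    by (simp add: card_Un_disjoint finite_S2_index Suc card_cartesian_product)
  then show ?case by (cases n) (simp_all add: numeral_2_eq_2)
qed

lemma card_H2_index: "card (H2_index n) = (n - 1) choose 2"
proof -
  \<comment> \<open>The shift in \<open>b + 1\<close> turns \<open>1 \<le> b\<close> into
    \<open>2 \<le> j\<close>, and \<open>1 \<le> a\<close> into \<open>j \<le> i\<close>.\<close>
  have "bij_betw (\<lambda>(a, b). (a + b, b + 1)) (H2_index n) (S2_index n)"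
    by (rule bij_betw_byWitness[where f' = "\<lambda>(i, j). (i - (j - 1), j - 1)"])
      (auto simp: H2_index_def S2_index_def)
  then show ?thesis using card_S2_index by (simp add: bij_betw_same_card)
qed

lemma H2_slice: "1 \<le> a \<Longrightarrow> {b. (a, b) \<in> H2_index n} = {1..n - 1 - a}"
  by (auto simp: H2_index_def)

lemma S2_slice: "2 \<le> i \<Longrightarrow> i \<le> n - 1 \<Longrightarrow> {j. (i, j) \<in> S2_index n} = {2..i}"
  by (auto simp: S2_index_def)

lemma det_H2_block:
  assumes xs: "is_ordering xs (H2_index n)"
  shows "det (block_mat fst xs xs) \<noteq> 0"
proof (rule det_block_mat)
  show "distinct xs" using xs by (simp add: is_ordering_def)
  have set: "set xs = H2_index n" using xs by (simp add: is_ordering_def)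
  fix h :: "nat \<times> nat \<Rightarrow> int"
  assume *: "\<And>x. x \<in> set xs \<Longrightarrow> (\<Sum>c | (fst x, c) \<in> set xs. int (c choose snd x) * h (fst x, c)) = 0"
  show "\<forall>y\<in>set xs. h y = 0"
  proof (clarify)
    fix a b assume ab: "(a, b) \<in> set xs"
    then have a: "1 \<le> a" "1 \<le> b" "b \<le> n - 1 - a" by (auto simp: set H2_index_def)
    have "(\<Sum>c=1..n - 1 - a. int (c choose k) * h (a, c)) = 0" if "1 \<le> k" "k \<le> n - 1 - a" for k
      using *[of "(a, k)"] that a(1) H2_slice[of a n] by (auto simp: set H2_index_def)
    from choose_triangular_kernel[OF this a(2,3)] show "h (a, b) = 0" .
  qed
qed simp

text \<open>Slice \<open>i\<close> has the rows \<open>(i - k, k)\<close> with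
  \<open>1 \<le> k < i\<close> and the columns \<open>2..i\<close>, which is the system of
  \<open>choose_shifted_kernel\<close>.\<close>

lemma det_S2_block:
  assumes xs: "is_ordering xs (H2_index n)" and ys: "is_ordering ys (S2_index n)"
  shows "det (block_mat (\<lambda>x. fst x + snd x) xs ys) \<noteq> 0"
proof (rule det_block_mat)
  show "distinct ys" using ys by (simp add: is_ordering_def)
  have setx: "set xs = H2_index n" using xs by (simp add: is_ordering_def)
  have sety: "set ys = S2_index n" using ys by (simp add: is_ordering_def)
  show "length xs = length ys"
    using xs ys unfolding is_ordering_def by (metis card_H2_index card_S2_index distinct_card)
  fix h :: "nat \<times> nat \<Rightarrow> int"
  assume *: "\<And>x. x \<in> set xs \<Longrightarrow>
    (\<Sum>c | (fst x + snd x, c) \<in> set ys. int (c choose snd x) * h (fst x + snd x, c)) = 0"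
  show "\<forall>y\<in>set ys. h y = 0"
  proof (clarify)
    fix i j assume "(i, j) \<in> set ys"
    then have ij: "2 \<le> i" "i \<le> n - 1" "2 \<le> j" "j \<le> i" by (auto simp: sety S2_index_def)
    have "(\<Sum>c=2..i. int (c choose k) * h (i, c)) = 0" if "1 \<le> k" "k < i" for k
      using *[of "(i - k, k)"] that ij S2_slice[of i n] by (auto simp: setx sety H2_index_def)
    from choose_shifted_kernel[OF ij(1) this ij(3,4)] show "h (i, j) = 0" .
  qed
qed

text \<open>This is \<open>P\<close>. Outside row 1 an entry counts the stars with \<open>k\<close>
  edges centred at a vertex of degree \<open>b\<close>; row 1 differs because a single edge has two
  possible centres.\<close>

definition star_mat :: "nat \<Rightarrow> rat mat" where
  "star_mat n = mat n n (\<lambda>(k, b).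
     if k = 1 then if b = 0 then 0 else of_nat (n - 1) * (2 - of_nat b) / 2
     else of_nat (b choose k))"

lemma star_mat_carrier: "star_mat n \<in> carrier_mat n n"
  by (simp add: star_mat_def)

text \<open>The matrix is triangular with diagonal entries 1, apart from \<open>(n - 1) / 2\<close>
  in row 1, which exists only for \<open>n\<close> at least 2.\<close>

lemma det_star_mat: "det (star_mat n) \<noteq> 0"
proof -
  have "upper_triangular (star_mat n)"
    by (auto simp: star_mat_def binomial_eq_0)
  then have "det (star_mat n) = prod_list (diag_mat (star_mat n))"
    using star_mat_carrier by (rule det_upper_triangular)
  also have "\<dots> \<noteq> 0"
    by (auto simp: prod_list_zero_iff diag_mat_def star_mat_def split: if_splits)
  finally show ?thesis .
qed

text \<open>The only denominators come from the factor \<open>(n - 1) / 2\<close> of row 1, an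
  integer for odd \<open>n\<close>.\<close>

lemma star_mat_integral:
  assumes "k < n" "b < n"
  shows "(if k = 1 \<and> even n then 2 * star_mat n $$ (k, b) else star_mat n $$ (k, b)) \<in> \<int>"
proof (cases "k = 1 \<and> odd n \<and> b \<noteq> 0")
  case True
  then obtain m where "n = 2 * m + 1" by (elim conjE oddE)
  then have "star_mat n $$ (k, b) = of_nat m * (2 - of_nat b)"
    using assms True by (simp add: star_mat_def)
  with True show ?thesis by simp
next
  case False
  with assms show ?thesis by (auto simp: star_mat_def)
qed

section \<open>The matrices applied to the counts of a tree\<close>

context finite_tree
begin

lemma star_mat_mult: "star_mat (card V) *\<^sub>v H1_vec (card V) V E = S1_vec (card V) V E"
proof (rule eq_vecI)
  fix k assume "k < dim_vec (S1_vec (card V) V E)"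
  then have k: "k < card V" by (simp add: S1_vec_def)
  then have "(star_mat (card V) *\<^sub>v H1_vec (card V) V E) $ k
      = (\<Sum>b<card V. star_mat (card V) $$ (k, b) * of_nat (eta_T V E 0 b))"
    by (simp add: star_mat_def H1_vec_def scalar_prod_def lessThan_atLeast0)
  also have "\<dots> = of_nat (s_T V E k k)"
  proof (cases "k = 1")
    case True
    with k show ?thesis using eta_row_1 by (simp add: star_mat_def cong: sum.cong_simp)
  next
    case False
    then have "(\<Sum>b<card V. star_mat (card V) $$ (k, b) * of_nat (eta_T V E 0 b))
      = (\<Sum>b<card V. of_nat (b choose k) * of_nat (eta_T V E 0 b))"
      using k by (intro sum.cong) (auto simp: star_mat_def)
    also have "\<dots> = (\<Sum>j<card V. of_nat (j choose k) * of_nat (s_T V E k j))"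
      using eta_eq_s[of 0 k] False by simp
    \<comment> \<open>Below \<open>k\<close> the binomial vanishes, and above \<open>k\<close> the
      count \<open>s_T\<close> does, since leaf edges are edges.\<close>
    also have "\<dots> = (\<Sum>j\<in>{k}. of_nat (j choose k) * of_nat (s_T V E k j))"
    proof (rule sum.mono_neutral_right)
      show "\<forall>j\<in>{..<card V} - {k}. of_nat (j choose k) * of_nat (s_T V E k j) = (0 :: rat)"
        using s_eq_0[of k] by (auto simp: binomial_eq_0 neq_iff)
    qed (use k in auto)
    finally show ?thesis by simp
  qed
  finally show "(star_mat (card V) *\<^sub>v H1_vec (card V) V E) $ k = S1_vec (card V) V E $ k"
    using k by (simp add: S1_vec_def)
qed (simp add: star_mat_def S1_vec_def)

text \<open>Row \<open>(a, k)\<close> of the two products gives the two sides of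
  \<open>eta_eq_s\<close>, since terms outside the index sets are zero.\<close>

lemma block_mat_mult_eq:
  assumes xs: "is_ordering xs (H2_index (card V))" and ys: "is_ordering ys (S2_index (card V))"
  shows "block_mat fst xs xs *\<^sub>v H2_vec xs V E
    = block_mat (\<lambda>x. fst x + snd x) xs ys *\<^sub>v S2_vec ys V E"
proof (rule eq_vecI)
  have x: "distinct xs" "set xs = H2_index (card V)" using xs by (simp_all add: is_ordering_def)
  have y: "distinct ys" "set ys = S2_index (card V)" using ys by (simp_all add: is_ordering_def)
  fix p assume "p < dim_vec (block_mat (\<lambda>x. fst x + snd x) xs ys *\<^sub>v S2_vec ys V E)"
  then have p: "p < length xs" by (simp add: block_mat_def)
  obtain a k where ak: "xs ! p = (a, k)" by fastforce
  then have "(a, k) \<in> H2_index (card V)" using p x(2) nth_mem by metis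
  then have *: "1 \<le> a" "1 \<le> k" "a + k \<le> card V - 1" by (auto simp: H2_index_def)
  have "(block_mat fst xs xs *\<^sub>v H2_vec xs V E) $ p
      = (\<Sum>b=1..card V - 1 - a. int (b choose k) * int (eta_T V E a b))"
    unfolding H2_vec_def using block_mat_mult[OF x(1) p] * by (simp add: ak x(2) H2_slice)
  also have "\<dots> = (\<Sum>b<card V. int (b choose k) * int (eta_T V E a b))"
  proof (rule sum.mono_neutral_left)
    show "\<forall>b\<in>{..<card V} - {1..card V - 1 - a}. int (b choose k) * int (eta_T V E a b) = 0"
    proof
      fix b assume "b \<in> {..<card V} - {1..card V - 1 - a}"
      \<comment> \<open>At \<open>b = 0\<close> the binomial vanishes because \<open>k\<close> is
        positive; beyond the slice there are no subtrees to count.\<close>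
      then have "b = 0 \<or> card V \<le> a + b" by auto
      then show "int (b choose k) * int (eta_T V E a b) = 0"
        using *(2) eta_eq_0[of a b] by (auto simp: binomial_eq_0)
    qed
  qed (use * in auto)
  also have "\<dots> = (\<Sum>j<card V. int (j choose k) * int (s_T V E (a + k) j))"
    using eta_eq_s[of a k] * by simp
  also have "\<dots> = (\<Sum>j=2..a + k. int (j choose k) * int (s_T V E (a + k) j))"
  proof (rule sum.mono_neutral_right)
    show "\<forall>j\<in>{..<card V} - {2..a + k}. int (j choose k) * int (s_T V E (a + k) j) = 0"
    proof
      fix j assume "j \<in> {..<card V} - {2..a + k}"
      then have "j < 2 \<or> a + k < j" by auto
      then have "s_T V E (a + k) j = 0" using * by (intro s_eq_0) auto
      then show "int (j choose k) * int (s_T V E (a + k) j) = 0" by simp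
    qed
  qed (use * in auto)
  also have "\<dots> = (block_mat (\<lambda>x. fst x + snd x) xs ys *\<^sub>v S2_vec ys V E) $ p"
    unfolding S2_vec_def using block_mat_mult[OF y(1) p, of "\<lambda>x. fst x + snd x"] *
    by (simp add: ak y(2) S2_slice)
  finally show "(block_mat fst xs xs *\<^sub>v H2_vec xs V E) $ p
    = (block_mat (\<lambda>x. fst x + snd x) xs ys *\<^sub>v S2_vec ys V E) $ p" .
qed (simp add: block_mat_def)

end

text \<open>\<open>P\<close> is rational; the integrality clause confines denominators to row 1 with
  \<open>n\<close> even, where they are at most 2. The matrices are chosen before the tree, so one
  choice serves all trees on \<open>n\<close> vertices.\<close>

theorem theorem4p1:
  fixes n :: nat and xs ys :: "(nat \<times> nat) list"
  assumes "is_ordering xs (H2_index n)"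
    and "is_ordering ys (S2_index n)"
  shows "\<exists>(P :: rat mat) (M :: int mat) (N :: int mat).
    P \<in> carrier_mat n n \<and> det P \<noteq> 0 \<and>
    (\<forall>k<n. \<forall>b<n. (if k = 1 \<and> even n then 2 * P $$ (k, b) else P $$ (k, b)) \<in> \<int>) \<and>
    M \<in> carrier_mat ((n - 1) choose 2) ((n - 1) choose 2) \<and> det M \<noteq> 0 \<and>
    N \<in> carrier_mat ((n - 1) choose 2) ((n - 1) choose 2) \<and> det N \<noteq> 0 \<and>
    (\<forall>(V :: 'a set) E. is_tree V E \<and> card V = n \<longrightarrow>
       P *\<^sub>v H1_vec n V E = S1_vec n V E \<and>
       M *\<^sub>v H2_vec xs V E = N *\<^sub>v S2_vec ys V E)"
proof (rule exI[of _ "star_mat n"], rule exI[of _ "block_mat fst xs xs"],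
    rule exI[of _ "block_mat (\<lambda>x. fst x + snd x) xs ys"], intro conjI allI impI)
  have len: "length xs = (n - 1) choose 2" "length ys = (n - 1) choose 2"
    using assms distinct_card card_H2_index card_S2_index by (metis is_ordering_def)+
  show "block_mat fst xs xs \<in> carrier_mat ((n - 1) choose 2) ((n - 1) choose 2)"
    "block_mat (\<lambda>x. fst x + snd x) xs ys \<in> carrier_mat ((n - 1) choose 2) ((n - 1) choose 2)"
    using block_mat_carrier len by metis+
next
  fix k b assume "k < n" "b < n"
  then show "(if k = 1 \<and> even n then 2 * star_mat n $$ (k, b) else star_mat n $$ (k, b)) \<in> \<int>"
    by (rule star_mat_integral)
next
  fix V :: "'a set" and E
  assume VE: "is_tree V E \<and> card V = n"
  then interpret finite_tree V E
    by unfold_locales (auto simp: is_tree_def)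
  show "star_mat n *\<^sub>v H1_vec n V E = S1_vec n V E"
    "block_mat fst xs xs *\<^sub>v H2_vec xs V E = block_mat (\<lambda>x. fst x + snd x) xs ys *\<^sub>v S2_vec ys V E"
    using star_mat_mult block_mat_mult_eq VE assms by auto
qed (use assms in \<open>simp_all add: star_mat_carrier det_star_mat det_H2_block det_S2_block\<close>)

end
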